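(* Let $n$ be a positive integer and let $A = e_1 A^- + e_2 A^+$ be a matrix in $\mathbb{C}_2^{n\times n}$, with $A^-, A^+$ complex $n\times n$ matrices. Then $A$ is a $\mathbb{C}_2$-idempotent matrix if and only if $A^-$ and $A^+$ are idempotent matrices.
   Context: $\mathbb{C}_1$ is the field of complex numbers (imaginary unit $i_1$). The bicomplex numbers are $\mathbb{C}_2 = \{z_1 + i_2 z_2 : z_1,z_2\in\mathbb{C}_1\}$, a commutative ring with $i_1^2=i_2^2=-1$ and $i_1 i_2 = i_2 i_1$. Put $e_1 = (1+i_1 i_2)/2$ and $e_2 = (1-i_1 i_2)/2$; these satisfy $e_1^2=e_1$, $e_2^2=e_2$, $e_1e_2=0$, $e_1+e_2=1$. Every $\xi = z_1+i_2 z_2\in\mathbb{C}_2$ is written uniquely as $\xi = \xi^- e_1 + \xi^+ e_2$ with $\xi^- = z_1 - i_1 z_2$ and $\xi^+ = z_1 + i_1 z_2$ in $\mathbb{C}_1$. $\mathbb{C}_2^{n\times n}$ is the set of $n\times n$ matrices with bicomplex entries, with the usual matrix operations. Every $A=[\xi_{ij}]\in\mathbb{C}_2^{n\times n}$ decomposes uniquely as $A = e_1A^-+e_2A^+$ with complex matrices $A^-=[\xi_{ij}^-]$, $A^+=[\xi_{ij}^+]$. A matrix $A\in\mathbb{C}_2^{n\times n}$ is called $\mathbb{C}_2$-idempotent if $A^2=A$. *)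

theory Defs
  imports Complex_Main "Jordan_Normal_Form.Matrix"
begin

text \<open>\<open>Bicomplex z1 z2\<close> stands for $z_1 + i_2 z_2$; see \<open>Bicomplex_eq\<close> below.\<close>

datatype bicomplex = Bicomplex (bc_fst: complex) (bc_snd: complex)

lemma bicomplex_eq_iff: "x = y \<longleftrightarrow> bc_fst x = bc_fst y \<and> bc_snd x = bc_snd y"
  by (cases x; cases y) simp

instantiation bicomplex :: comm_ring_1
begin

definition zero_bicomplex :: bicomplex where
  "0 = Bicomplex 0 0"

definition one_bicomplex :: bicomplex where
  "1 = Bicomplex 1 0"

definition plus_bicomplex :: "bicomplex \<Rightarrow> bicomplex \<Rightarrow> bicomplex" where
  "x + y = Bicomplex (bc_fst x + bc_fst y) (bc_snd x + bc_snd y)"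

definition uminus_bicomplex :: "bicomplex \<Rightarrow> bicomplex" where
  "- x = Bicomplex (- bc_fst x) (- bc_snd x)"

definition minus_bicomplex :: "bicomplex \<Rightarrow> bicomplex \<Rightarrow> bicomplex" where
  "x - y = Bicomplex (bc_fst x - bc_fst y) (bc_snd x - bc_snd y)"

definition times_bicomplex :: "bicomplex \<Rightarrow> bicomplex \<Rightarrow> bicomplex" where
  "x * y = Bicomplex (bc_fst x * bc_fst y - bc_snd x * bc_snd y)
                     (bc_fst x * bc_snd y + bc_snd x * bc_fst y)"

instance
  by standard
     (simp_all add: bicomplex_eq_iff zero_bicomplex_def one_bicomplex_def plus_bicomplex_def
        uminus_bicomplex_def minus_bicomplex_def times_bicomplex_def algebra_simps)

end

lemmas bicomplex_defs = zero_bicomplex_def one_bicomplex_def plus_bicomplex_def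
  uminus_bicomplex_def minus_bicomplex_def times_bicomplex_def

definition bc_of_complex :: "complex \<Rightarrow> bicomplex" where
  "bc_of_complex z = Bicomplex z 0"

definition bc_i1 :: bicomplex where
  "bc_i1 = bc_of_complex \<i>"

definition bc_i2 :: bicomplex where
  "bc_i2 = Bicomplex 0 1"

lemma Bicomplex_eq: "Bicomplex z1 z2 = bc_of_complex z1 + bc_i2 * bc_of_complex z2"
  by (simp add: bicomplex_defs bc_of_complex_def bc_i2_def)

lemma bc_i1_square: "bc_i1 * bc_i1 = - 1"
  and bc_i2_square: "bc_i2 * bc_i2 = - 1"
  by (simp_all add: bicomplex_defs bc_of_complex_def bc_i1_def bc_i2_def)

text \<open>Bicomplex numbers have zero divisors, so there is no division on the type;
  the factor $1/2$ is a complex scalar.\<close>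

definition bc_e1 :: bicomplex where
  "bc_e1 = bc_of_complex (1 / 2) * (1 + bc_i1 * bc_i2)"

definition bc_e2 :: bicomplex where
  "bc_e2 = bc_of_complex (1 / 2) * (1 - bc_i1 * bc_i2)"

definition bc_minus :: "bicomplex \<Rightarrow> complex" where
  "bc_minus x = bc_fst x - \<i> * bc_snd x"

definition bc_plus :: "bicomplex \<Rightarrow> complex" where
  "bc_plus x = bc_fst x + \<i> * bc_snd x"

lemma bc_decomposition_iff:
  "x = bc_e1 * bc_of_complex u + bc_e2 * bc_of_complex v \<longleftrightarrow> u = bc_minus x \<and> v = bc_plus x"
proof -
  have "x = bc_e1 * bc_of_complex u + bc_e2 * bc_of_complex v \<longleftrightarrow>
      bc_fst x = (u + v) / 2 \<and> bc_snd x = \<i> * (u - v) / 2"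
    by (simp add: bicomplex_eq_iff bicomplex_defs bc_of_complex_def bc_i1_def bc_i2_def
        bc_e1_def bc_e2_def field_simps)
  also have "\<dots> \<longleftrightarrow> u = bc_minus x \<and> v = bc_plus x"
    unfolding bc_minus_def bc_plus_def by (auto simp: complex_eq_iff field_simps)
  finally show ?thesis .
qed

text \<open>Existence and uniqueness of the decomposition $A = e_1 A^- + e_2 A^+$, where $A^-$ and
  $A^+$ are given entrywise.\<close>

lemma bc_mat_decomposition_iff:
  assumes "A \<in> carrier_mat n n" "B \<in> carrier_mat n n" "C \<in> carrier_mat n n"
  shows "A = bc_e1 \<cdot>\<^sub>m map_mat bc_of_complex B + bc_e2 \<cdot>\<^sub>m map_mat bc_of_complex C
    \<longleftrightarrow> B = map_mat bc_minus A \<and> C = map_mat bc_plus A"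
proof -
  have "A = bc_e1 \<cdot>\<^sub>m map_mat bc_of_complex B + bc_e2 \<cdot>\<^sub>m map_mat bc_of_complex C \<longleftrightarrow>
      (\<forall>i<n. \<forall>j<n. A $$ (i, j) =
      bc_e1 * bc_of_complex (B $$ (i, j)) + bc_e2 * bc_of_complex (C $$ (i, j)))"
    using assms by (auto simp: mat_eq_iff)
  also have "\<dots> \<longleftrightarrow> B = map_mat bc_minus A \<and> C = map_mat bc_plus A"
    using assms by (auto simp: bc_decomposition_iff mat_eq_iff)
  finally show ?thesis .
qed

text \<open>For bicomplex entries this is $\mathbb{C}_2$-idempotency.\<close>

definition idempotent_mat :: "'a :: semiring_1 mat \<Rightarrow> bool" where
  "idempotent_mat A \<longleftrightarrow> square_mat A \<and> A ^\<^sub>m 2 = A"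

end

theory Submission
  imports Defs
begin

text \<open>The component maps \<^const>\<open>bc_minus\<close> and \<^const>\<open>bc_plus\<close> are ring homomorphisms onto the
  complex numbers and together they separate points. Applied entrywise, they commute with matrix
  powers, so the equation $A^2 = A$ holds iff it holds in both components.\<close>

text \<open>\<open>bc_minus\<close> substitutes -\<i> for \<open>bc_i2\<close>, and
  \<open>bc_plus\<close> substitutes \<i>; products are respected since both values square to -1, as
  \<open>bc_i2\<close> does.\<close>

lemma semiring_hom_bc_minus: "semiring_hom bc_minus"
  by standard (simp_all add: bc_minus_def bicomplex_defs algebra_simps)

lemma semiring_hom_bc_plus: "semiring_hom bc_plus"
  by standard (simp_all add: bc_plus_def bicomplex_defs algebra_simps)

text \<open>The two components rebuild the number as its coefficients at \<open>bc_e1\<close> and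
  \<open>bc_e2\<close>.\<close>

lemma bicomplex_eq_components_iff:
  "x = y \<longleftrightarrow> bc_minus x = bc_minus y \<and> bc_plus x = bc_plus y"
  by (metis bc_decomposition_iff)

lemma bicomplex_mat_eq_components_iff:
  assumes "A \<in> carrier_mat m n" "B \<in> carrier_mat m n"
  shows "A = B \<longleftrightarrow>
    map_mat bc_minus A = map_mat bc_minus B \<and> map_mat bc_plus A = map_mat bc_plus B"
  using assms by (auto simp: mat_eq_iff bicomplex_eq_components_iff)

theorem theorem4p4:
  fixes n :: nat
    and A :: "bicomplex mat"
    and A_minus A_plus :: "complex mat"
  assumes "n > 0"
    and "A \<in> carrier_mat n n"
    and "A_minus \<in> carrier_mat n n"
    and "A_plus \<in> carrier_mat n n"
    and "A = bc_e1 \<cdot>\<^sub>m map_mat bc_of_complex A_minus + bc_e2 \<cdot>\<^sub>m map_mat bc_of_complex A_plus"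
  shows "idempotent_mat A \<longleftrightarrow> idempotent_mat A_minus \<and> idempotent_mat A_plus"
proof -
  \<comment> \<open>By uniqueness of the decomposition, the given matrices are the entrywise
    components of \<open>A\<close>.\<close>
  have components: "A_minus = map_mat bc_minus A" "A_plus = map_mat bc_plus A"
    using bc_mat_decomposition_iff[OF assms(2-4)] assms(5) by auto
  have "A ^\<^sub>m 2 = A \<longleftrightarrow>
      map_mat bc_minus (A ^\<^sub>m 2) = A_minus \<and> map_mat bc_plus (A ^\<^sub>m 2) = A_plus"
    using bicomplex_mat_eq_components_iff[OF pow_carrier_mat[OF assms(2)] assms(2)]
    unfolding components .
  also have "\<dots> \<longleftrightarrow> A_minus ^\<^sub>m 2 = A_minus \<and> A_plus ^\<^sub>m 2 = A_plus"
    using semiring_hom.mat_hom_pow[OF semiring_hom_bc_minus assms(2)]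
      semiring_hom.mat_hom_pow[OF semiring_hom_bc_plus assms(2)]
    by (simp add: components)
  finally show ?thesis
    using assms(2-4) by (simp add: idempotent_mat_def)
qed

end
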